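(* Let $T\ge 2$ be an integer and $D>0$. Assume: (1) $F:[1,T]\times\mathbb{R}\times\mathbb{R}\times\mathbb{R}\to\mathbb{R}$, $(k,x,y,u)\mapsto F(k,x,y,u)$, is continuous and differentiable with respect to its second and third variables, and the partial derivatives $F_x,F_y:[1,T]\times\mathbb{R}\times\mathbb{R}\times\mathbb{R}\to\mathbb{R}$ are continuous. (2) For every fixed $y\in H$ there are a constant $\beta_1\in\mathbb{R}$, a function $\gamma_1:[1,T]\to\mathbb{R}$ and a constant $\alpha_1<1/(2c_2)$ such that $F(k,x,y(k),u)\ge-\alpha_1|x|^2+\beta_1x+\gamma_1(k)$ for all $x\in\mathbb{R}$, all $u\in\mathbb{R}$ with $|u|\le D$ and all $k\in[1,T]$. (3) For every fixed $x\in H$ there are a constant $\beta_2\in\mathbb{R}$, a function $\gamma_2:[1,T]\to\mathbb{R}$ and a constant $\alpha_2<1/(2c_2)$ such that $F(k,x(k),y,u)\le\alpha_2|y|^2+\beta_2y+\gamma_2(k)$ for all $y\in\mathbb{R}$, all $u\in\mathbb{R}$ with $|u|\le D$ and all $k\in[1,T]$. (4) For all $y\in H$ and $u\in L_D$, the functional $x\mapsto J_u(x,y)$ is convex on $H$. (5) For all $x\in H$ and $u\in L_D$, the functional $y\mapsto J_u(x,y)$ is concave on $H$. Then for every $u\in L_D$ there exists at least one pair $(x,y)\in V_u$ which is a solution of the boundary value problem $(P_u)$. Moreover, let $(u_n)_{n\ge1}\subset L_D$ be a convergent sequence with $\lim_{n\to\infty}u_n=u_0\in L_D$. For any sequence $((x_n,y_n))_{n\ge1}$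 of solutions $(x_n,y_n)\in V_{u_n}$ of $(P_{u_n})$, there exist a subsequence $((x_{n_i},y_{n_i}))_{i\ge1}$ and an element $(x_0,y_0)\in H\times H$ such that $\lim_{i\to\infty}x_{n_i}=x_0$, $\lim_{i\to\infty}y_{n_i}=y_0$ and $J_{u_0}(x_0,y_0)=\max_{y\in H}\min_{x\in H}J_{u_0}(x,y)$. Moreover $(x_0,y_0)\in V_{u_0}$, and the pair $(x_0,y_0)$ satisfies $(P_{u_0})$, i.e. for all $k\in[1,T]$ $$\Delta^2x_0(k-1)=F_x(k,x_0(k),y_0(k),u_0(k)),\qquad \Delta^2y_0(k-1)=-F_y(k,x_0(k),y_0(k),u_0(k)),$$ and $x_0(0)=x_0(T+1)=y_0(0)=y_0(T+1)=0$.
   Context: For integers $a<b$, $[a,b]$ denotes the discrete interval $\{a,a+1,\dots,b\}$ (discrete topology). $\Delta x(k)=x(k+1)-x(k)$ is the forward difference operator and $\Delta^2x(k-1)=x(k+1)-2x(k)+x(k-1)$. $H=\{x:[0,T+1]\to\mathbb{R}: x(0)=x(T+1)=0\}$ with norm $\|x\|=\big(\sum_{k=1}^{T+1}|\Delta x(k-1)|^2\big)^{1/2}$ (a finite-dimensional Hilbert space). $c_2$ is the smallest positive constant such that $\sum_{k=1}^T|x(k)|^2\le c_2\sum_{k=1}^{T+1}|\Delta x(k-1)|^2$ for all $x\in H$. $L_D=\{u:[1,T]\to\mathbb{R}: \max_{k\in[1,T]}|u(k)|\le D\}$, with convergence in the maximum norm. For $u\in L_D$, $(P_u)$ is the boundary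 value problem: $\Delta^2x(k-1)=F_x(k,x(k),y(k),u(k))$ and $\Delta^2y(k-1)=-F_y(k,x(k),y(k),u(k))$ for $k\in[1,T]$, with $x(0)=x(T+1)=y(0)=y(T+1)=0$; a solution is a pair $(x,y)$ of real functions on $[0,T+1]$ satisfying these equations and boundary conditions. For $u\in L_D$, the action functional $J_u:H\times H\to\mathbb{R}$ is $$J_u(x,y)=\sum_{k=1}^{T+1}\left(\frac{|\Delta x(k-1)|^2}{2}-\frac{|\Delta y(k-1)|^2}{2}\right)+\sum_{k=1}^TF(k,x(k),y(k),u(k)).$$ A saddle point of $J_u$ is a pair $(\overline x,\overline y)\in H\times H$ with $J_u(\overline x,y)\le J_u(\overline x,\overline y)\le J_u(x,\overline y)$ for all $x,y\in H$. $V_u$ denotes the set of all saddle points of $J_u$. *)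

theory Defs
  imports "HOL-Analysis.Analysis"
begin

(* A real function on a discrete interval A is encoded as a function on nat that vanishes
   off A, so that functions on A correspond one-to-one to elements of this set and the set is
   closed under pointwise linear combinations. *)
definition funs_on :: "nat set \<Rightarrow> (nat \<Rightarrow> real) set" where
  "funs_on A = {x. \<forall>k. k \<notin> A \<longrightarrow> x k = 0}"

definition fdiff :: "(nat \<Rightarrow> real) \<Rightarrow> nat \<Rightarrow> real" where
  "fdiff x k = x (k + 1) - x k"

definition fdiff2 :: "(nat \<Rightarrow> real) \<Rightarrow> nat \<Rightarrow> real" where
  "fdiff2 x k = fdiff (fdiff x) k"

lemma fdiff2_pred: "k \<ge> 1 \<Longrightarrow> fdiff2 x (k - 1) = x (k + 1) - 2 * x k + x (k - 1)"
  by (simp add: fdiff2_def fdiff_def)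

definition H :: "nat \<Rightarrow> (nat \<Rightarrow> real) set" where
  "H T = {x \<in> funs_on {0..T+1}. x 0 = 0 \<and> x (T+1) = 0}"

definition H_norm :: "nat \<Rightarrow> (nat \<Rightarrow> real) \<Rightarrow> real" where
  "H_norm T x = sqrt (\<Sum>k=1..T+1. \<bar>fdiff x (k - 1)\<bar>\<^sup>2)"

definition c2 :: "nat \<Rightarrow> real" where
  "c2 T = (LEAST c. 0 < c \<and>
     (\<forall>x\<in>H T. (\<Sum>k=1..T. \<bar>x k\<bar>\<^sup>2) \<le> c * (\<Sum>k=1..T+1. \<bar>fdiff x (k - 1)\<bar>\<^sup>2)))"

definition max_norm :: "nat \<Rightarrow> (nat \<Rightarrow> real) \<Rightarrow> real" where
  "max_norm T u = Max ((\<lambda>k. \<bar>u k\<bar>) ` {1..T})"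

definition L :: "nat \<Rightarrow> real \<Rightarrow> (nat \<Rightarrow> real) set" where
  "L T D = {u \<in> funs_on {1..T}. max_norm T u \<le> D}"

definition partial_x ::
  "(nat \<Rightarrow> real \<Rightarrow> real \<Rightarrow> real \<Rightarrow> real) \<Rightarrow> nat \<Rightarrow> real \<Rightarrow> real \<Rightarrow> real \<Rightarrow> real" where
  "partial_x F k x y u = deriv (\<lambda>s. F k s y u) x"

definition partial_y ::
  "(nat \<Rightarrow> real \<Rightarrow> real \<Rightarrow> real \<Rightarrow> real) \<Rightarrow> nat \<Rightarrow> real \<Rightarrow> real \<Rightarrow> real \<Rightarrow> real" where
  "partial_y F k x y u = deriv (\<lambda>s. F k x s u) y"

definition solves_P ::
  "nat \<Rightarrow> (nat \<Rightarrow> real \<Rightarrow> real \<Rightarrow> real \<Rightarrow> real) \<Rightarrow> (nat \<Rightarrow> real) \<Rightarrow>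
   (nat \<Rightarrow> real) \<Rightarrow> (nat \<Rightarrow> real) \<Rightarrow> bool" where
  "solves_P T F u x y \<longleftrightarrow>
     x \<in> funs_on {0..T+1} \<and> y \<in> funs_on {0..T+1} \<and>
     (\<forall>k\<in>{1..T}. fdiff2 x (k - 1) = partial_x F k (x k) (y k) (u k) \<and>
                 fdiff2 y (k - 1) = - partial_y F k (x k) (y k) (u k)) \<and>
     x 0 = 0 \<and> x (T+1) = 0 \<and> y 0 = 0 \<and> y (T+1) = 0"

definition J ::
  "nat \<Rightarrow> (nat \<Rightarrow> real \<Rightarrow> real \<Rightarrow> real \<Rightarrow> real) \<Rightarrow> (nat \<Rightarrow> real) \<Rightarrow>
   (nat \<Rightarrow> real) \<Rightarrow> (nat \<Rightarrow> real) \<Rightarrow> real" where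
  "J T F u x y =
     (\<Sum>k=1..T+1. \<bar>fdiff x (k - 1)\<bar>\<^sup>2 / 2 - \<bar>fdiff y (k - 1)\<bar>\<^sup>2 / 2)
     + (\<Sum>k=1..T. F k (x k) (y k) (u k))"

definition V ::
  "nat \<Rightarrow> (nat \<Rightarrow> real \<Rightarrow> real \<Rightarrow> real \<Rightarrow> real) \<Rightarrow> (nat \<Rightarrow> real) \<Rightarrow>
   ((nat \<Rightarrow> real) \<times> (nat \<Rightarrow> real)) set" where
  "V T F u = {(a, b). a \<in> H T \<and> b \<in> H T \<and>
     (\<forall>x\<in>H T. \<forall>y\<in>H T. J T F u a y \<le> J T F u a b \<and> J T F u a b \<le> J T F u x b)}"

(* The library's convex_on needs a real_vector type, which nat => real is not. *)
definition convex_functional :: "(nat \<Rightarrow> real) set \<Rightarrow> ((nat \<Rightarrow> real) \<Rightarrow> real) \<Rightarrow> bool" where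
  "convex_functional S f \<longleftrightarrow>
     (\<forall>x\<in>S. \<forall>z\<in>S. \<forall>t\<in>{0..1}.
        f (\<lambda>k. (1 - t) * x k + t * z k) \<le> (1 - t) * f x + t * f z)"

definition concave_functional :: "(nat \<Rightarrow> real) set \<Rightarrow> ((nat \<Rightarrow> real) \<Rightarrow> real) \<Rightarrow> bool" where
  "concave_functional S f \<longleftrightarrow> convex_functional S (\<lambda>x. - f x)"

definition is_minimum :: "real set \<Rightarrow> real \<Rightarrow> bool" where
  "is_minimum S m \<longleftrightarrow> m \<in> S \<and> (\<forall>s\<in>S. m \<le> s)"

definition is_maximum :: "real set \<Rightarrow> real \<Rightarrow> bool" where
  "is_maximum S m \<longleftrightarrow> m \<in> S \<and> (\<forall>s\<in>S. s \<le> m)"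

(* v = max over y in B of min over x in A of f x y, including the claim that every inner
   minimum and the outer maximum are attained. *)
definition is_max_min :: "'a set \<Rightarrow> 'b set \<Rightarrow> ('a \<Rightarrow> 'b \<Rightarrow> real) \<Rightarrow> real \<Rightarrow> bool" where
  "is_max_min A B f v \<longleftrightarrow>
     (\<exists>m. (\<forall>y\<in>B. is_minimum ((\<lambda>x. f x y) ` A) (m y)) \<and> is_maximum (m ` B) v)"

lemma poincare:
  assumes "x \<in> H T"
  shows "(\<Sum>k=1..T. \<bar>x k\<bar>\<^sup>2) \<le> (real T + 1)\<^sup>2 * (\<Sum>k=1..T+1. \<bar>fdiff x (k - 1)\<bar>\<^sup>2)"
proof -
  let ?S = "\<Sum>k=1..T+1. \<bar>fdiff x (k - 1)\<bar>\<^sup>2"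
  have S: "?S = (\<Sum>j<T+1. (fdiff x j)\<^sup>2)"
    by (rule sum.reindex_bij_witness[of _ Suc "\<lambda>k. k - 1"]) auto
  have "\<bar>x k\<bar>\<^sup>2 \<le> (T + 1) * ?S" if k: "k \<in> {1..T}" for k
  proof -
    have "(\<Sum>j<k. fdiff x j) = x k"
      using sum_lessThan_telescope[of x k] assms by (simp add: fdiff_def H_def)
    then have "\<bar>x k\<bar>\<^sup>2 = (\<Sum>j<k. fdiff x j * 1)\<^sup>2" by simp
    also have "\<dots> \<le> (\<Sum>j<k. (fdiff x j)\<^sup>2) * (\<Sum>j<k. 1\<^sup>2)"
      by (rule Cauchy_Schwarz_ineq_sum)
    also have "\<dots> \<le> (\<Sum>j<T+1. (fdiff x j)\<^sup>2) * (T + 1)"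
      using k by (intro mult_mono sum_mono2) (auto intro!: sum_nonneg add_nonneg_nonneg)
    finally show ?thesis by (simp only: S mult.commute)
  qed
  then have "(\<Sum>k=1..T. \<bar>x k\<bar>\<^sup>2) \<le> T * ((T + 1) * ?S)"
    using sum_bounded_above[of "{1..T}" "\<lambda>k. \<bar>x k\<bar>\<^sup>2"] by simp
  also have "\<dots> \<le> (T + 1) * ((T + 1) * ?S)"
    by (intro mult_right_mono mult_nonneg_nonneg sum_nonneg) auto
  also have "\<dots> = (real T + 1)\<^sup>2 * ?S"
    by (simp only: power2_eq_square[of "real T + 1"] mult.assoc of_nat_add of_nat_1)
  finally show ?thesis .
qed

lemma least_constant:
  fixes N S :: "'a \<Rightarrow> real"
  assumes S: "\<And>x. x \<in> X \<Longrightarrow> 0 \<le> S x"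
    and C: "0 < C" "\<And>x. x \<in> X \<Longrightarrow> N x \<le> C * S x"
    and a: "a \<in> X" "0 < N a"
  defines "A \<equiv> {c. 0 < c \<and> (\<forall>x\<in>X. N x \<le> c * S x)}"
  shows "is_minimum A (LEAST c. 0 < c \<and> (\<forall>x\<in>X. N x \<le> c * S x))"
proof -
  have ne: "A \<noteq> {}" using C by (auto simp: A_def)
  have Sa: "0 < S a"
    using S[OF a(1)] C(2)[OF a(1)] a(2) by (cases "S a = 0") auto
  have bdd: "bdd_below A" by (rule bdd_belowI[of _ 0]) (auto simp: A_def)
  have inf: "N x / S x \<le> Inf A" if "x \<in> X" "0 < S x" for x
    by (rule cInf_greatest[OF ne]) (use that in \<open>auto simp: A_def divide_le_eq\<close>)
  have "0 < N a / S a" using a Sa by simp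
  also have "\<dots> \<le> Inf A" using inf a Sa by simp
  finally have pos: "0 < Inf A" .
  have ineq: "N x \<le> Inf A * S x" if x: "x \<in> X" for x
  proof (cases "S x = 0")
    case True
    then show ?thesis using C(2)[OF x] by simp
  next
    case False
    then have "0 < S x" using S[OF x] by simp
    then show ?thesis using inf[OF x] by (simp add: divide_le_eq)
  qed
  have low: "Inf A \<le> c" if "c \<in> A" for c using that bdd by (rule cInf_lower)
  have "(LEAST c. 0 < c \<and> (\<forall>x\<in>X. N x \<le> c * S x)) = Inf A"
    by (rule Least_equality) (use pos ineq low in \<open>auto simp: A_def\<close>)
  then show ?thesis using pos ineq low by (auto simp: is_minimum_def A_def)
qed

(* The LEAST in the definition of c2 is attained. *)
lemma c2_least:
  assumes "T \<ge> 1"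
  shows "is_minimum {c. 0 < c \<and>
     (\<forall>x\<in>H T. (\<Sum>k=1..T. \<bar>x k\<bar>\<^sup>2) \<le> c * (\<Sum>k=1..T+1. \<bar>fdiff x (k - 1)\<bar>\<^sup>2))} (c2 T)"
  unfolding c2_def
proof (rule least_constant[where C = "(real T + 1)\<^sup>2" and a = "\<lambda>k. if k = 1 then 1 else 0"])
  let ?e = "\<lambda>k::nat. if k = 1 then 1 else 0 :: real"
  show "?e \<in> H T" using assms by (auto simp: H_def funs_on_def)
  show "0 < (\<Sum>k=1..T. \<bar>?e k\<bar>\<^sup>2)"
    by (rule sum_pos2[of _ 1]) (use assms in auto)
  show "0 < (real T + 1)\<^sup>2"
    using of_nat_0_le_iff[of T, where 'a = real] by (intro zero_less_power) linarith
qed (rule sum_nonneg, simp, rule poincare)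

end

(* For coercive payoffs a saddle point (a, b) is confined by J(a, 0) <= J(a, b) <= J(0, b), uniformly
   in u, and the inequalities defining saddle points pass to limits. Hence sequences of saddle points
   have subsequences converging to saddle points. Existence uses the same limit: on the boxes
   |x(k)|, |y(k)| <= n the functional J + e_n |x|^2 with e_n -> 0 is strictly convex in x and
   therefore has a saddle point there, and these converge along a subsequence. A saddle point solves
   the boundary value problem because the partial derivatives of J in the coordinates x(k), y(k)
   vanish there. *)
theory Submission
  imports Defs
begin

text \<open>Function types carry the product topology, whose convergence is coordinatewise. Limits
  of elements of \<open>H T\<close> are taken in this sense and turned into norm convergence only at
  the end.\<close>

lemma tendsto_fun_iff:
  "(f \<longlongrightarrow> l) G \<longleftrightarrow> (\<forall>i. ((\<lambda>n. f n i) \<longlongrightarrow> l i) G)"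
  for f :: "'b \<Rightarrow> 'i \<Rightarrow> 'a::topological_space"
  using limitin_componentwise[of "\<lambda>_. euclidean" UNIV f l G]
  by (simp add: euclidean_product_topology)

subsection \<open>A minimax theorem on compact sets\<close>

lemma compact_attains_partial_minimum:
  fixes f :: "'a::topological_space \<Rightarrow> 'b::topological_space \<Rightarrow> real"
  assumes "compact A" "A \<noteq> {}" "continuous_on (A \<times> B) (\<lambda>(x, y). f x y)" "y \<in> B"
  shows "\<exists>x\<in>A. \<forall>w\<in>A. f x y \<le> f w y"
proof -
  have "continuous_on A ((\<lambda>(x, y). f x y) \<circ> (\<lambda>x. (x, y)))"
    by (rule continuous_on_compose)
       (use assms(4) in \<open>auto intro!: continuous_intros continuous_on_subset[OF assms(3)]\<close>)
  then have "continuous_on A (\<lambda>x. f x y)" by (simp add: comp_def)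
  then show ?thesis using continuous_attains_inf assms(1,2) by blast
qed

lemma concave_functionalD:
  assumes "concave_functional S f" "x \<in> S" "z \<in> S" "t \<in> {0..1}"
  shows "(1 - t) * f x + t * f z \<le> f (\<lambda>k. (1 - t) * x k + t * z k)"
  using assms unfolding concave_functional_def convex_functional_def
  by (fastforce simp: algebra_simps)

text \<open>The witness \<open>b\<close> maximises \<open>\<phi> y = min\<^sub>x f x y\<close>, and \<open>a\<close> is the minimiser at \<open>b\<close>. To compare with \<open>y\<close>,
  move from \<open>b\<close> towards \<open>y\<close> by a small \<open>t\<close>: concavity and \<open>\<phi> z \<le> \<phi> b\<close> give \<open>f (m z) y \<le> \<phi> b\<close>, and
  by uniqueness \<open>m z\<close> accumulates at \<open>a\<close> as \<open>t\<close> tends to 0.\<close>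

lemma minimax_unique_minimizers:
  fixes f :: "'a::metric_space \<Rightarrow> (nat \<Rightarrow> real) \<Rightarrow> real"
  assumes A: "compact A" "A \<noteq> {}" and B: "compact B" "B \<noteq> {}"
    and convB: "\<And>y z t. y \<in> B \<Longrightarrow> z \<in> B \<Longrightarrow> t \<in> {0..1} \<Longrightarrow> (\<lambda>k. (1 - t) * y k + t * z k) \<in> B"
    and cont: "continuous_on (A \<times> B) (\<lambda>(x, y). f x y)"
    and unique: "\<And>x z y. y \<in> B \<Longrightarrow> x \<in> A \<Longrightarrow> z \<in> A \<Longrightarrow>
      \<forall>w\<in>A. f x y \<le> f w y \<Longrightarrow> \<forall>w\<in>A. f z y \<le> f w y \<Longrightarrow> x = z"
    and concave: "\<And>x. x \<in> A \<Longrightarrow> concave_functional B (f x)"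
  shows "\<exists>a\<in>A. \<exists>b\<in>B. \<forall>x\<in>A. \<forall>y\<in>B. f a y \<le> f a b \<and> f a b \<le> f x b"
proof -
  have lim: "(\<lambda>n. f (x n) (y n)) \<longlonglongrightarrow> f a b"
    if "x \<longlonglongrightarrow> a" "y \<longlonglongrightarrow> b" "a \<in> A" "b \<in> B" "\<And>n. x n \<in> A" "\<And>n. y n \<in> B" for x y a b
    using continuous_on_tendsto_compose[OF cont tendsto_Pair[OF that(1,2)]] that by simp
  obtain m where m: "\<And>y. y \<in> B \<Longrightarrow> m y \<in> A" "\<And>x y. y \<in> B \<Longrightarrow> x \<in> A \<Longrightarrow> f (m y) y \<le> f x y"
    using compact_attains_partial_minimum[OF A cont] by metis
  define \<phi> where "\<phi> y = f (m y) y" for y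
  obtain b where b: "b \<in> B" and \<phi>b: "\<And>y. y \<in> B \<Longrightarrow> \<phi> y \<le> \<phi> b"
  proof -
    have "bounded ((\<lambda>(x, y). f x y) ` (A \<times> B))"
      by (intro compact_imp_bounded compact_continuous_image cont compact_Times A B)
    then obtain K where "\<And>z. z \<in> (\<lambda>(x, y). f x y) ` (A \<times> B) \<Longrightarrow> norm z \<le> K"
      unfolding bounded_iff by blast
    then have K: "f x y \<le> K" if "x \<in> A" "y \<in> B" for x y
      using that by (force simp: abs_le_iff)
    have bdd: "bdd_above (\<phi> ` B)"
      using K m by (intro bdd_aboveI[of _ K]) (auto simp: \<phi>_def)
    define S where "S = Sup (\<phi> ` B)"
    have "\<exists>y\<in>B. S - inverse (real (Suc n)) < \<phi> y" for n
      using less_cSup_iff[of "\<phi> ` B" "S - inverse (real (Suc n))"] B(2) bdd by (auto simp: S_def)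
    then obtain y where y: "\<And>n. y n \<in> B" "\<And>n. S - inverse (real (Suc n)) < \<phi> (y n)"
      by metis
    obtain b r where br: "b \<in> B" "strict_mono r" "(y \<circ> r) \<longlonglongrightarrow> b"
      using seq_compactE[OF compact_imp_seq_compact[OF B(1)], of y] y(1) by metis
    \<comment> \<open>Only upper semicontinuity of \<open>\<phi>\<close> is used: for each fixed
      \<open>x\<close> the values \<open>\<phi> (y n)\<close> lie below \<open>f x (y n)\<close>,
      and this passes to the limit \<open>b\<close>. Afterwards \<open>x = m b\<close> is
      inserted.\<close>
    have "S \<le> f x b" if x: "x \<in> A" for x
    proof (rule LIMSEQ_le)
      show "(\<lambda>n. f x ((y \<circ> r) n)) \<longlonglongrightarrow> f x b"
        by (rule lim) (use br x y in \<open>auto simp: comp_def\<close>)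
      show "(\<lambda>n. S - inverse (real (Suc (r n)))) \<longlonglongrightarrow> S"
        using LIMSEQ_subseq_LIMSEQ[OF tendsto_diff[OF tendsto_const LIMSEQ_inverse_real_of_nat] br(2)]
        by (simp add: comp_def)
      have "S - inverse (real (Suc (r n))) \<le> f x ((y \<circ> r) n)" for n
        using y(2)[of "r n"] m(2)[OF y(1) x, of "r n"] by (simp add: \<phi>_def)
      then show "\<exists>N. \<forall>n\<ge>N. S - inverse (real (Suc (r n))) \<le> f x ((y \<circ> r) n)" by blast
    qed
    then have "S \<le> \<phi> b" using m br by (simp add: \<phi>_def)
    moreover have "\<phi> y \<le> S" if "y \<in> B" for y
      unfolding S_def using that bdd by (simp add: cSup_upper)
    ultimately show ?thesis using that br(1) by force
  qed
  have "f (m b) y \<le> \<phi> b" if y: "y \<in> B" for y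
  proof -
    define t where "t n = inverse (real (Suc n))" for n
    have t: "0 < t n" "t n \<le> 1" for n by (auto simp: t_def inverse_le_1_iff)
    define z where "z n = (\<lambda>k. (1 - t n) * b k + t n * y k)" for n
    have z: "z n \<in> B" for n unfolding z_def using convB b y t[of n] by (simp add: less_imp_le)
    have t0: "t \<longlonglongrightarrow> 0" unfolding t_def by (rule LIMSEQ_inverse_real_of_nat)
    obtain a r where ar: "a \<in> A" "strict_mono r" "((\<lambda>n. m (z n)) \<circ> r) \<longlonglongrightarrow> a"
      using seq_compactE[OF compact_imp_seq_compact[OF A(1)], of "\<lambda>n. m (z n)"] m(1) z by metis
    have "z \<longlonglongrightarrow> b"
      unfolding tendsto_fun_iff
    proof
      fix i
      have "(\<lambda>n. (1 - t n) * b i + t n * y i) \<longlonglongrightarrow> (1 - 0) * b i + 0 * y i"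
        by (intro tendsto_intros t0)
      then show "(\<lambda>n. z n i) \<longlonglongrightarrow> b i" by (simp add: z_def)
    qed
    then have zr: "(z \<circ> r) \<longlonglongrightarrow> b" using ar(2) by (rule LIMSEQ_subseq_LIMSEQ)
    \<comment> \<open>Minimality of \<open>m (z n)\<close> at \<open>z n\<close> passes to the
      limit, so the accumulation point \<open>a\<close> is a minimiser at \<open>b\<close> and
      uniqueness identifies it with \<open>m b\<close>.\<close>
    have "f a b \<le> f x b" if x: "x \<in> A" for x
    proof (rule LIMSEQ_le)
      show "(\<lambda>n. f (((\<lambda>n. m (z n)) \<circ> r) n) ((z \<circ> r) n)) \<longlonglongrightarrow> f a b"
        by (rule lim) (use zr ar b m z in \<open>auto simp: comp_def\<close>)
      show "(\<lambda>n. f x ((z \<circ> r) n)) \<longlonglongrightarrow> f x b"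
        by (rule lim) (use zr ar b x z in \<open>auto simp: comp_def\<close>)
    qed (use m z x in auto)
    then have "a = m b" using unique[OF b ar(1) m(1)[OF b]] m(2)[OF b] by blast
    \<comment> \<open>Concavity bounds the average of the values at \<open>b\<close> and
      \<open>y\<close> by \<open>\<phi> (z n)\<close>. As
      \<open>\<phi> b \<le> f (m (z n)) b\<close>, the multiples of \<open>\<phi> b\<close> combine,
      and the positive factor \<open>t n\<close> is divided out.\<close>
    have le: "f (m (z n)) y \<le> \<phi> b" for n
    proof -
      have "(1 - t n) * \<phi> b + t n * f (m (z n)) y
          \<le> (1 - t n) * f (m (z n)) b + t n * f (m (z n)) y"
        using m z b t[of n] by (auto simp: \<phi>_def intro!: mult_left_mono)
      also have "\<dots> \<le> f (m (z n)) (z n)"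
        using concave_functionalD[OF concave[OF m(1)[OF z]] b y, of "t n"] t[of n]
        by (simp add: z_def less_imp_le)
      also have "\<dots> \<le> \<phi> b" using \<phi>b[OF z] by (simp add: \<phi>_def)
      finally have "t n * f (m (z n)) y \<le> t n * \<phi> b" by (simp add: algebra_simps)
      then show ?thesis using t[of n] by simp
    qed
    have "(\<lambda>n. f (((\<lambda>n. m (z n)) \<circ> r) n) y) \<longlonglongrightarrow> f a y"
      by (rule lim) (use ar y m z in \<open>auto simp: comp_def\<close>)
    then have "f a y \<le> \<phi> b" by (rule LIMSEQ_le_const2) (use le in auto)
    then show ?thesis by (simp add: \<open>a = m b\<close>)
  qed
  then show ?thesis using m b by (auto simp: \<phi>_def intro!: bexI[of _ "m b"] bexI[of _ b])
qed

subsection \<open>The action functional\<close>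

text \<open>It has two roles: it is the left side of the inequality behind \<open>c2\<close>, hence
  the measure of coercivity, and it is the strictly convex term that regularizes
  \<open>J\<close>.\<close>

definition sumsq :: "nat \<Rightarrow> (nat \<Rightarrow> real) \<Rightarrow> real" where
  "sumsq T x = (\<Sum>k=1..T. (x k)\<^sup>2)"

text \<open>Members vanish off \<open>{1..T}\<close>, so bounding every coordinate adds only the
  condition \<open>0 \<le> R\<close>; for negative \<open>R\<close> the box is empty.\<close>

definition H_box :: "nat \<Rightarrow> real \<Rightarrow> (nat \<Rightarrow> real) set" where
  "H_box T R = {x \<in> H T. \<forall>k. \<bar>x k\<bar> \<le> R}"

section \<open>The space \<open>H T\<close> and its boxes\<close>

lemma H_iff: "x \<in> H T \<longleftrightarrow> (\<forall>k. k \<notin> {1..T} \<longrightarrow> x k = 0)"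
proof -
  have "k \<notin> {1..T} \<longleftrightarrow> k \<notin> {0..T+1} \<or> k = 0 \<or> k = T + 1" for k by auto
  then show ?thesis by (auto simp: H_def funs_on_def)
qed

lemma zero_in_H: "(\<lambda>_. 0) \<in> H T"
  by (simp add: H_iff)

lemma combination_in_H: "x \<in> H T \<Longrightarrow> z \<in> H T \<Longrightarrow> (\<lambda>k. a * x k + b * z k) \<in> H T"
  by (simp add: H_iff)

lemma update_in_H: "x \<in> H T \<Longrightarrow> k \<in> {1..T} \<Longrightarrow> x(k := t) \<in> H T"
  by (auto simp: H_iff)

lemma compact_H_box: "compact (H_box T R)"
proof -
  \<comment> \<open>The factor \<open>{0} \<inter> {-R..R}\<close> is empty for negative
    \<open>R\<close>, so the description as a product holds for every \<open>R\<close>; compactness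
    is then Tychonoff's theorem.\<close>
  let ?S = "\<lambda>k. if k \<in> {1..T} then {-R..R} else {0} \<inter> {-R..R}"
  have "H_box T R = PiE UNIV ?S"
    by (auto simp: H_box_def H_iff PiE_iff abs_le_iff minus_le_iff split: if_splits)
       (metis minus_le_iff, metis)
  moreover have "compactin (product_topology (\<lambda>_. euclidean) UNIV) (PiE UNIV ?S)"
    by (subst compactin_PiE) auto
  ultimately show ?thesis by (simp add: euclidean_product_topology)
qed

lemma combination_in_H_box:
  assumes "x \<in> H_box T R" "z \<in> H_box T R" "t \<in> {0..1}"
  shows "(\<lambda>k. (1 - t) * x k + t * z k) \<in> H_box T R"
proof -
  have "\<bar>(1 - t) * x k + t * z k\<bar> \<le> R" for k
  proof -
    have "\<bar>(1 - t) * x k + t * z k\<bar> \<le> (1 - t) * \<bar>x k\<bar> + t * \<bar>z k\<bar>"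
      using assms(3) by (intro order.trans[OF abs_triangle_ineq]) (simp add: abs_mult)
    also have "\<dots> \<le> R"
      using assms by (intro convex_bound_le) (auto simp: H_box_def)
    finally show ?thesis .
  qed
  then show ?thesis using assms combination_in_H by (simp add: H_box_def)
qed

text \<open>Each coordinate is at most the square root of \<open>M\<close>, which is below
  \<open>M + 1\<close>; the cruder bound keeps square roots out.\<close>

lemma abs_le_if_sumsq_le:
  assumes "x \<in> H T" "sumsq T x \<le> M"
  shows "\<bar>x k\<bar> \<le> M + 1"
proof -
  have M: "0 \<le> M" using assms(2) sum_nonneg[of "{1..T}" "\<lambda>k. (x k)\<^sup>2"] by (simp add: sumsq_def)
  show ?thesis
  proof (cases "k \<in> {1..T}")
    case True
    then have "\<bar>x k\<bar>\<^sup>2 \<le> M"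
      using member_le_sum[of k "{1..T}" "\<lambda>k. (x k)\<^sup>2"] assms(2) by (simp add: sumsq_def)
    moreover have "(M + 1)\<^sup>2 = M\<^sup>2 + 2 * M + 1" by (simp add: power2_sum)
    ultimately have "\<bar>x k\<bar>\<^sup>2 \<le> (M + 1)\<^sup>2" using M zero_le_power2[of M] by linarith
    then show ?thesis by (rule power2_le_imp_le) (use M in simp)
  next
    case False
    then show ?thesis using assms(1) M by (simp add: H_iff)
  qed
qed

text \<open>Strict convexity at the midpoint, from the parallelogram identity. The weight
  \<open>1 - 1/2\<close> is left unsimplified to match the combinations in
  \<open>convex_functional\<close>.\<close>

lemma sumsq_midpoint:
  assumes "x \<in> H T" "z \<in> H T" "x \<noteq> z"
  shows "2 * sumsq T (\<lambda>k. (1 - 1/2) * x k + 1/2 * z k) < sumsq T x + sumsq T z"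
proof -
  obtain k where k: "k \<in> {1..T}" "x k \<noteq> z k" using assms by (metis H_iff ext)
  have id: "2 * ((1 - 1/2) * x i + 1/2 * z i)\<^sup>2 = (x i)\<^sup>2 + (z i)\<^sup>2 - (x i - z i)\<^sup>2 / 2" for i
    by (simp add: power2_eq_square field_simps)
  have "0 < (\<Sum>i=1..T. (x i - z i)\<^sup>2 / 2)"
    by (rule sum_pos2[OF _ k(1)]) (use k in auto)
  then show ?thesis
    unfolding sumsq_def sum_distrib_left id sum.distrib sum_subtractf by linarith
qed

section \<open>Limits and coercivity of \<open>J\<close>\<close>

lemma L_bound: "u \<in> L T D \<Longrightarrow> k \<in> {1..T} \<Longrightarrow> \<bar>u k\<bar> \<le> D"
  by (auto simp: L_def max_norm_def intro: order.trans[OF Max_ge])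

text \<open>Exchanging the two players reduces statements about \<open>y\<close> to statements about \<open>x\<close>.\<close>

lemma J_swap: "J T F u x y = - J T (\<lambda>k x y u. - F k y x u) u y x"
  by (simp add: J_def sum_subtractf sum_negf)

lemma tendsto_on_discrete_slice:
  fixes F :: "nat \<Rightarrow> real \<Rightarrow> real \<Rightarrow> real \<Rightarrow> real"
  assumes "continuous_on (K \<times> UNIV \<times> UNIV \<times> UNIV) (\<lambda>(k, x, y, u). F k x y u)" "k \<in> K"
    and "(x \<longlongrightarrow> a) G" "(y \<longlongrightarrow> b) G" "(u \<longlongrightarrow> c) G"
  shows "((\<lambda>n. F k (x n) (y n) (u n)) \<longlongrightarrow> F k a b c) G"
  using continuous_on_tendsto_compose[OF assms(1)
      tendsto_Pair[OF tendsto_const tendsto_Pair[OF assms(3) tendsto_Pair[OF assms(4,5)]]], of k]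
    assms(2) by simp

lemma J_tendsto:
  assumes F: "continuous_on ({1..T} \<times> UNIV \<times> UNIV \<times> UNIV) (\<lambda>(k, x, y, u). F k x y u)"
    and "\<And>k. ((\<lambda>n. x n k) \<longlongrightarrow> a k) G" "\<And>k. ((\<lambda>n. y n k) \<longlongrightarrow> b k) G"
      "\<And>k. k \<in> {1..T} \<Longrightarrow> ((\<lambda>n. u n k) \<longlongrightarrow> c k) G"
  shows "((\<lambda>n. J T F (u n) (x n) (y n)) \<longlongrightarrow> J T F c a b) G"
  unfolding J_def fdiff_def
  by (intro tendsto_intros tendsto_on_discrete_slice[OF F] assms) auto

lemma sumsq_tendsto:
  assumes "\<And>k. ((\<lambda>n. x n k) \<longlongrightarrow> a k) G"
  shows "((\<lambda>n. sumsq T (x n)) \<longlongrightarrow> sumsq T a) G"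
  unfolding sumsq_def by (intro tendsto_intros assms)

text \<open>The quadratic part of \<open>x\<close> in \<open>J\<close> is at least
  \<open>sumsq T x / (2 * c2 T)\<close> by the choice of \<open>c2\<close>, and this beats the loss
  \<open>\<alpha> * sumsq T x\<close> allowed by the growth condition. The constants depend on
  \<open>y\<close> but not on \<open>u\<close>, which makes the confinement of saddle points uniform
  in the control.\<close>

lemma J_coercive:
  assumes T: "T \<ge> 1"
    and \<alpha>: "\<alpha> < 1 / (2 * c2 T)"
    and growth: "\<And>s v k. k \<in> {1..T} \<Longrightarrow> \<bar>v\<bar> \<le> D \<Longrightarrow>
      F k s (y k) v \<ge> - \<alpha> * \<bar>s\<bar>\<^sup>2 + \<beta> * s + \<gamma> k"
  shows "\<exists>c>0. \<exists>C. \<forall>u\<in>L T D. \<forall>x\<in>H T. c * sumsq T x - C \<le> J T F u x y"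
proof -
  \<comment> \<open>\<open>\<delta>\<close> is the gap between the two quadratic rates. One half of
    it absorbs the linear term by completing the square, at the cost
    \<open>\<beta>\<^sup>2 / (2 * \<delta>)\<close> per coordinate; the other half remains as the
    coercivity constant.\<close>
  define \<delta> where "\<delta> = 1 / (2 * c2 T) - \<alpha>"
  define C where "C = (\<Sum>k=1..T+1. \<bar>fdiff y (k - 1)\<bar>\<^sup>2 / 2) - (\<Sum>k=1..T. \<gamma> k - \<beta>\<^sup>2 / (2 * \<delta>))"
  have \<delta>: "\<delta> > 0" using \<alpha> by (simp add: \<delta>_def)
  have c2: "0 < c2 T" "\<And>x. x \<in> H T \<Longrightarrow> sumsq T x \<le> c2 T * (\<Sum>k=1..T+1. \<bar>fdiff x (k - 1)\<bar>\<^sup>2)"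
    using c2_least[OF T] by (simp_all add: is_minimum_def sumsq_def)
  have "\<delta> / 2 * sumsq T x - C \<le> J T F u x y" if u: "u \<in> L T D" and x: "x \<in> H T" for u x
  proof -
    have "\<delta> / 2 * (x k)\<^sup>2 - 1 / (2 * c2 T) * (x k)\<^sup>2 + (\<gamma> k - \<beta>\<^sup>2 / (2 * \<delta>)) \<le> F k (x k) (y k) (u k)"
      if k: "k \<in> {1..T}" for k
    proof -
      have "0 \<le> (\<delta> * x k + \<beta>)\<^sup>2 / (2 * \<delta>)" using \<delta> by simp
      also have "\<dots> = \<delta> / 2 * (x k)\<^sup>2 + \<beta> * x k + \<beta>\<^sup>2 / (2 * \<delta>)"
        using \<delta> by (simp add: power2_eq_square field_simps)
      finally have "- \<delta> / 2 * (x k)\<^sup>2 - \<beta>\<^sup>2 / (2 * \<delta>) \<le> \<beta> * x k" by simp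
      moreover have "\<alpha> * (x k)\<^sup>2 = 1 / (2 * c2 T) * (x k)\<^sup>2 - \<delta> * (x k)\<^sup>2"
        by (simp add: \<delta>_def algebra_simps)
      ultimately show ?thesis
        using growth[OF k L_bound[OF u k], of "x k"] by simp
    qed
    then have "(\<Sum>k=1..T. \<delta> / 2 * (x k)\<^sup>2 - 1 / (2 * c2 T) * (x k)\<^sup>2 + (\<gamma> k - \<beta>\<^sup>2 / (2 * \<delta>)))
        \<le> (\<Sum>k=1..T. F k (x k) (y k) (u k))"
      by (rule sum_mono)
    moreover have "(\<Sum>k=1..T. \<delta> / 2 * (x k)\<^sup>2 - 1 / (2 * c2 T) * (x k)\<^sup>2 + (\<gamma> k - \<beta>\<^sup>2 / (2 * \<delta>)))
        = \<delta> / 2 * sumsq T x - 1 / (2 * c2 T) * sumsq T x + (\<Sum>k=1..T. \<gamma> k - \<beta>\<^sup>2 / (2 * \<delta>))"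
      by (simp only: sum.distrib sum_subtractf sumsq_def sum_distrib_left)
    moreover have "1 / (2 * c2 T) * sumsq T x \<le> (\<Sum>k=1..T+1. \<bar>fdiff x (k - 1)\<bar>\<^sup>2) / 2"
      using c2(1) c2(2)[OF x] by (simp add: field_simps)
    ultimately show ?thesis
      unfolding J_def C_def sum_subtractf sum_divide_distrib by linarith
  qed
  then show ?thesis using \<delta> by (intro exI[of _ "\<delta> / 2"]) auto
qed

subsection \<open>Saddle points\<close>

text \<open>Varying the single coordinate \<open>x k\<close> gives a differentiable function of one
  real variable with a minimum at the current value, so its derivative vanishes there.\<close>

lemma partial_minimizer_Euler:
  assumes x: "x \<in> H T" and k: "k \<in> {1..T}"
    and diff: "(\<lambda>s. F k s (y k) (u k)) differentiable (at (x k))"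
    and min: "\<And>z. z \<in> H T \<Longrightarrow> J T F u x y \<le> J T F u z y"
  shows "fdiff2 x (k - 1) = partial_x F k (x k) (y k) (u k)"
proof -
  \<comment> \<open>\<open>?e j\<close> is the derivative of coordinate \<open>j\<close> of
    \<open>x(k := s)\<close> with respect to \<open>s\<close>.\<close>
  let ?e = "\<lambda>j. of_bool (j = k) :: real"
  let ?P = "partial_x F k (x k) (y k) (u k)"
  have upd: "((\<lambda>s. (x(k := s)) j) has_real_derivative ?e j) (at (x k))" for j
    by (cases "j = k") (auto intro!: derivative_eq_intros)
  have "((\<lambda>s. F j ((x(k := s)) j) (y j) (u j)) has_real_derivative (if j = k then ?P else 0)) (at (x k))" for j
    using diff by (auto simp: partial_x_def DERIV_deriv_iff_real_differentiable)
  then have F': "((\<lambda>s. \<Sum>j=1..T. F j ((x(k := s)) j) (y j) (u j)) has_real_derivative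
      (\<Sum>j=1..T. if j = k then ?P else 0)) (at (x k))"
    by (intro DERIV_sum)
  have "((\<lambda>s. J T F u (x(k := s)) y) has_real_derivative
      (\<Sum>j=1..T+1. fdiff x (j - 1) * (?e (j - 1 + 1) - ?e (j - 1)))
      + (\<Sum>j=1..T. if j = k then ?P else 0)) (at (x k))"
  proof -
    have "((\<lambda>s. \<bar>fdiff (x(k := s)) (j - 1)\<bar>\<^sup>2 / 2 - \<bar>fdiff y (j - 1)\<bar>\<^sup>2 / 2) has_real_derivative
        fdiff x (j - 1) * (?e (j - 1 + 1) - ?e (j - 1))) (at (x k))" for j
    proof -
      have w: "((\<lambda>s. fdiff (x(k := s)) (j - 1)) has_real_derivative ?e (j - 1 + 1) - ?e (j - 1)) (at (x k))"
        unfolding fdiff_def by (rule DERIV_diff[OF upd upd])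
      show ?thesis
        unfolding power2_abs
        using DERIV_diff[OF DERIV_cdivide[OF DERIV_power[OF w, of 2], of 2] DERIV_const]
        by (simp add: mult.commute)
    qed
    then show ?thesis unfolding J_def by (intro DERIV_add[OF DERIV_sum F'])
  qed
  \<comment> \<open>Only two differences involve \<open>x k\<close>: the one with
    \<open>j = k\<close>, with sign plus, and the one with \<open>j = k + 1\<close>, with sign
    minus. Both indices lie in \<open>{1..T+1}\<close>.\<close>
  moreover have "(\<Sum>j=1..T+1. fdiff x (j - 1) * (?e (j - 1 + 1) - ?e (j - 1)))
      = (\<Sum>j=1..T+1. (if j = k then fdiff x (j - 1) else 0) - (if j = k + 1 then fdiff x (j - 1) else 0))"
    by (intro sum.cong) auto
  moreover have "\<dots> = fdiff x (k - 1) - fdiff x k"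
    using k by (simp add: sum_subtractf sum.delta del: sum.cl_ivl_Suc)
  ultimately have "((\<lambda>s. J T F u (x(k := s)) y) has_real_derivative
      fdiff x (k - 1) - fdiff x k + ?P) (at (x k))"
    using k by (simp add: sum.delta del: sum.cl_ivl_Suc)
  \<comment> \<open>The minimum is global on \<open>H T\<close>, so the radius \<open>1\<close> is
    arbitrary.\<close>
  then have "fdiff x (k - 1) - fdiff x k + ?P = 0"
    by (rule DERIV_local_min[where d = 1]) (use min[OF update_in_H[OF x k]] in auto)
  then show ?thesis using k by (simp add: fdiff2_def fdiff_def)
qed

text \<open>A pair is a saddle point of \<open>f\<close> on \<open>A \<times> A\<close> iff \<open>f a w \<le> f z b\<close> for all \<open>z, w \<in> A\<close>; this single
  inequality is the form that is passed to the limit.\<close>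

lemma approximate_saddles_limit:
  fixes u x y :: "nat \<Rightarrow> nat \<Rightarrow> real" and A :: "nat \<Rightarrow> (nat \<Rightarrow> real) set"
  assumes F: "continuous_on ({1..T} \<times> UNIV \<times> UNIV \<times> UNIV) (\<lambda>(k, x, y, u). F k x y u)"
    and low: "0 < c" "\<And>u x. u \<in> L T D \<Longrightarrow> x \<in> H T \<Longrightarrow> c * sumsq T x - C \<le> J T F u x (\<lambda>_. 0)"
    and upp: "0 < c'" "\<And>u y. u \<in> L T D \<Longrightarrow> y \<in> H T \<Longrightarrow> J T F u (\<lambda>_. 0) y \<le> C' - c' * sumsq T y"
    and u: "\<And>n. u n \<in> L T D" "\<And>k. k \<in> {1..T} \<Longrightarrow> (\<lambda>n. u n k) \<longlonglongrightarrow> v k"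
    and e: "\<And>n. 0 \<le> e n" "e \<longlonglongrightarrow> 0"
    and A: "\<And>n. A n \<subseteq> H T" "\<And>n. (\<lambda>_. 0) \<in> A n"
      "\<And>z. z \<in> H T \<Longrightarrow> eventually (\<lambda>n. z \<in> A n) sequentially"
    and xy: "\<And>n. x n \<in> A n" "\<And>n. y n \<in> A n"
    and saddle: "\<And>n z w. z \<in> A n \<Longrightarrow> w \<in> A n \<Longrightarrow>
      J T F (u n) (x n) w + e n * sumsq T (x n) \<le> J T F (u n) z (y n) + e n * sumsq T z"
  shows "\<exists>r a b. strict_mono r \<and> (a, b) \<in> V T F v \<and>
    (\<forall>k. (\<lambda>i. x (r i) k) \<longlonglongrightarrow> a k) \<and> (\<forall>k. (\<lambda>i. y (r i) k) \<longlonglongrightarrow> b k)"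
proof -
  have sumsq_nonneg: "0 \<le> sumsq T z" for z by (simp add: sumsq_def sum_nonneg)
  define M where "M = max ((C + C') / c) ((C + C') / c')"
  have "x n \<in> H_box T (M + 1)" "y n \<in> H_box T (M + 1)" for n
  proof -
    have H: "x n \<in> H T" "y n \<in> H T" using A(1) xy by blast+
    \<comment> \<open>Taking zero for both competitors, where the penalty of the right side
      vanishes, encloses the saddle inequality between the two coercivity bounds. This controls
      \<open>x n\<close> and \<open>y n\<close> together, uniformly in \<open>n\<close>.\<close>
    have "c * sumsq T (x n) - C \<le> J T F (u n) (x n) (\<lambda>_. 0) + e n * sumsq T (x n)"
      using low(2)[OF u(1) H(1), of n] mult_nonneg_nonneg[OF e(1) sumsq_nonneg, of n "x n"] by linarith
    also have "\<dots> \<le> J T F (u n) (\<lambda>_. 0) (y n)"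
      using saddle[OF A(2) A(2), of n] by (simp add: sumsq_def)
    also have "\<dots> \<le> C' - c' * sumsq T (y n)" by (rule upp(2)[OF u(1) H(2)])
    finally have le: "c * sumsq T (x n) + c' * sumsq T (y n) \<le> C + C'" by simp
    have "0 \<le> c * sumsq T (x n)" "0 \<le> c' * sumsq T (y n)"
      using low(1) upp(1) sumsq_nonneg by simp_all
    with le have "c * sumsq T (x n) \<le> C + C'" "c' * sumsq T (y n) \<le> C + C'"
      by linarith+
    then have "sumsq T (x n) \<le> (C + C') / c" "sumsq T (y n) \<le> (C + C') / c'"
      by (simp_all only: pos_le_divide_eq[OF low(1)] pos_le_divide_eq[OF upp(1)] mult.commute)
    then have "sumsq T (x n) \<le> M" "sumsq T (y n) \<le> M"
      unfolding M_def le_max_iff_disj by blast+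
    then show "x n \<in> H_box T (M + 1)" "y n \<in> H_box T (M + 1)"
      using abs_le_if_sumsq_le H by (simp_all add: H_box_def)
  qed
  then have "\<forall>n. (x n, y n) \<in> H_box T (M + 1) \<times> H_box T (M + 1)" by simp
  then obtain p r where p: "p \<in> H_box T (M + 1) \<times> H_box T (M + 1)" and r: "strict_mono r"
    and lim: "((\<lambda>n. (x n, y n)) \<circ> r) \<longlonglongrightarrow> p"
    by (rule seq_compactE[OF compact_imp_seq_compact[OF compact_Times[OF compact_H_box compact_H_box]]])
  obtain a b where ab: "p = (a, b)" by force
  have H: "a \<in> H T" "b \<in> H T" using p by (auto simp: ab H_box_def)
  have xa: "(\<lambda>i. x (r i) k) \<longlonglongrightarrow> a k" and yb: "(\<lambda>i. y (r i) k) \<longlonglongrightarrow> b k" for k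
    using tendsto_fst[OF lim] tendsto_snd[OF lim] by (simp_all add: tendsto_fun_iff ab comp_def)
  have ur: "(\<lambda>i. u (r i) k) \<longlonglongrightarrow> v k" if "k \<in> {1..T}" for k
    using LIMSEQ_subseq_LIMSEQ[OF u(2)[OF that] r] by (simp add: comp_def)
  have er: "(\<lambda>i. e (r i)) \<longlonglongrightarrow> 0" using LIMSEQ_subseq_LIMSEQ[OF e(2) r] by (simp add: comp_def)
  have "J T F v a w + 0 * sumsq T a \<le> J T F v z b + 0 * sumsq T z" if z: "z \<in> H T" and w: "w \<in> H T" for z w
  proof (rule tendsto_le[OF sequentially_bot])
    show "(\<lambda>i. J T F (u (r i)) (x (r i)) w + e (r i) * sumsq T (x (r i))) \<longlonglongrightarrow> J T F v a w + 0 * sumsq T a"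
      by (intro tendsto_intros J_tendsto[OF F] sumsq_tendsto xa ur er)
    show "(\<lambda>i. J T F (u (r i)) z (y (r i)) + e (r i) * sumsq T z) \<longlonglongrightarrow> J T F v z b + 0 * sumsq T z"
      by (intro tendsto_intros J_tendsto[OF F] yb ur er)
    \<comment> \<open>Fixed competitors may be missing from the first sets, so the inequality is
      available only from some index on, which suffices for the limit.\<close>
    have "eventually (\<lambda>i. z \<in> A (r i) \<and> w \<in> A (r i)) sequentially"
      by (rule eventually_subseq[OF r]) (intro eventually_conj A(3) z w)
    then show "\<forall>\<^sub>F i in sequentially. J T F (u (r i)) (x (r i)) w + e (r i) * sumsq T (x (r i))
        \<le> J T F (u (r i)) z (y (r i)) + e (r i) * sumsq T z"
      by eventually_elim (use saddle in auto)
  qed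
  then have "(a, b) \<in> V T F v" using H by (simp add: V_def)
  then show ?thesis using r xa yb by blast
qed

text \<open>The penalty makes the minimiser in \<open>x\<close> unique, as the minimax theorem
  requires, and being constant in \<open>y\<close> it preserves concavity there.\<close>

lemma regularized_saddle:
  assumes F: "continuous_on ({1..T} \<times> UNIV \<times> UNIV \<times> UNIV) (\<lambda>(k, x, y, u). F k x y u)"
    and convex: "\<And>y. y \<in> H T \<Longrightarrow> convex_functional (H T) (\<lambda>x. J T F u x y)"
    and concave: "\<And>x. x \<in> H T \<Longrightarrow> concave_functional (H T) (\<lambda>y. J T F u x y)"
    and R: "0 \<le> R" and e: "0 < e"
  shows "\<exists>a\<in>H_box T R. \<exists>b\<in>H_box T R. \<forall>x\<in>H_box T R. \<forall>y\<in>H_box T R.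
    J T F u a y + e * sumsq T a \<le> J T F u x b + e * sumsq T x"
proof -
  let ?B = "H_box T R" and ?f = "\<lambda>x y. J T F u x y + e * sumsq T x"
  have BH: "?B \<subseteq> H T" by (auto simp: H_box_def)
  have "\<exists>a\<in>?B. \<exists>b\<in>?B. \<forall>x\<in>?B. \<forall>y\<in>?B. ?f a y \<le> ?f a b \<and> ?f a b \<le> ?f x b"
  proof (rule minimax_unique_minimizers)
    show "?B \<noteq> {}" "?B \<noteq> {}" using R zero_in_H[of T] by (auto simp: H_box_def intro!: exI[of _ "\<lambda>_. 0"])
    show "continuous_on (?B \<times> ?B) (\<lambda>(x, y). ?f x y)"
      unfolding continuous_on_def
    proof
      fix p assume "p \<in> ?B \<times> ?B"
      have fst: "((\<lambda>q. fst q k) \<longlongrightarrow> fst p k) (at p within ?B \<times> ?B)"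
        and snd: "((\<lambda>q. snd q k) \<longlongrightarrow> snd p k) (at p within ?B \<times> ?B)" for k
        using tendsto_fst[OF tendsto_ident_at[of p]] tendsto_snd[OF tendsto_ident_at[of p]]
        by (simp_all add: tendsto_fun_iff)
      have "((\<lambda>q. ?f (fst q) (snd q)) \<longlongrightarrow> ?f (fst p) (snd p)) (at p within ?B \<times> ?B)"
        by (intro tendsto_intros J_tendsto[OF F] sumsq_tendsto fst snd)
      then show "((\<lambda>(x, y). ?f x y) \<longlongrightarrow> (case p of (x, y) \<Rightarrow> ?f x y)) (at p within ?B \<times> ?B)"
        by (simp add: case_prod_unfold)
    qed
    show "concave_functional ?B (?f x)" if x: "x \<in> ?B" for x
      unfolding concave_functional_def convex_functional_def
    proof (intro ballI)
      fix y z and t :: real assume "y \<in> ?B" "z \<in> ?B" "t \<in> {0..1}"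
      then show "- ?f x (\<lambda>k. (1 - t) * y k + t * z k) \<le> (1 - t) * - ?f x y + t * - ?f x z"
        using concave_functionalD[OF concave, of x y z t] x BH by (auto simp: algebra_simps)
    qed
    show "x = z" if y: "y \<in> ?B" and xz: "x \<in> ?B" "z \<in> ?B"
      and min: "\<forall>w\<in>?B. ?f x y \<le> ?f w y" "\<forall>w\<in>?B. ?f z y \<le> ?f w y" for x z y
    proof (rule ccontr)
      assume ne: "x \<noteq> z"
      have H: "x \<in> H T" "z \<in> H T" "y \<in> H T" using xz y BH by auto
      \<comment> \<open>The midpoint of two distinct minimisers stays in the box and would have a
        value strictly below the average of their minimal values.\<close>
      define m where "m = (\<lambda>k. (1 - 1/2) * x k + 1/2 * z k)"
      have "(1/2 :: real) \<in> {0..1}" by simp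
      then have J: "J T F u m y \<le> (1 - 1/2) * J T F u x y + 1/2 * J T F u z y"
        using convex[OF H(3)] H(1,2) unfolding convex_functional_def m_def by blast
      have m: "m \<in> ?B" using combination_in_H_box[OF xz, of "1/2"] by (simp add: m_def)
      have "e * (2 * sumsq T m) < e * (sumsq T x + sumsq T z)"
        using sumsq_midpoint[OF H(1,2) ne] e unfolding m_def by (intro mult_strict_left_mono)
      with J have "2 * ?f m y < ?f x y + ?f z y" by (simp add: algebra_simps)
      moreover have "?f x y \<le> ?f m y" "?f z y \<le> ?f m y" using min m by blast+
      ultimately show False by (smt (verit))
    qed
  qed (use compact_H_box combination_in_H_box in auto)
  then show ?thesis by (meson order.trans)
qed

text \<open>\<open>x\<close> minimises \<open>J\<close> for fixed \<open>y\<close>, while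
  \<open>y\<close> minimises \<open>- J\<close> for fixed \<open>x\<close>. The latter is the action
  functional of \<open>?G\<close>, so one Euler equation serves both, and the minus sign before
  \<open>F\<close> yields that before \<open>partial_y\<close>.\<close>

lemma saddle_point_solves:
  assumes V: "(x, y) \<in> V T F u"
    and "\<And>k x y u. k \<in> {1..T} \<Longrightarrow> (\<lambda>s. F k s y u) differentiable (at x)"
    and dy: "\<And>k x y u. k \<in> {1..T} \<Longrightarrow> (\<lambda>s. F k x s u) differentiable (at y)"
  shows "solves_P T F u x y"
proof -
  let ?G = "\<lambda>k x y u. - F k y x u"
  have H: "x \<in> H T" "y \<in> H T" using V by (auto simp: V_def)
  have "fdiff2 x (k - 1) = partial_x F k (x k) (y k) (u k)" if k: "k \<in> {1..T}" for k
    by (rule partial_minimizer_Euler[where T = T]) (use V k assms(2) in \<open>auto simp: V_def\<close>)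
  moreover have "fdiff2 y (k - 1) = - partial_y F k (x k) (y k) (u k)" if k: "k \<in> {1..T}" for k
  proof -
    have "fdiff2 y (k - 1) = partial_x ?G k (y k) (x k) (u k)"
    proof (rule partial_minimizer_Euler[where T = T and F = ?G])
      show "J T ?G u y x \<le> J T ?G u z x" if "z \<in> H T" for z
        using V that J_swap[of T F u x] by (auto simp: V_def)
      show "(\<lambda>s. - F k (x k) s (u k)) differentiable at (y k)"
        using dy[OF k] by (rule differentiable_minus)
    qed (use H k in auto)
    also have "\<dots> = - partial_y F k (x k) (y k) (u k)"
      unfolding partial_x_def partial_y_def
      using dy[OF k, of "x k" "u k" "y k"]
      by (intro DERIV_imp_deriv DERIV_minus) (simp add: DERIV_deriv_iff_real_differentiable)
    finally show ?thesis .
  qed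
  ultimately show ?thesis using H by (auto simp: solves_P_def H_def)
qed

text \<open>Coercivity makes the inner minimum attained for every \<open>y\<close>, not only at
  \<open>b\<close>. Testing with \<open>a\<close> bounds all these minima by the saddle value, and
  \<open>b\<close> attains it.\<close>

lemma saddle_value_is_max_min:
  assumes V: "(a, b) \<in> V T F u"
    and F: "continuous_on ({1..T} \<times> UNIV \<times> UNIV \<times> UNIV) (\<lambda>(k, x, y, u). F k x y u)"
    and coercive: "\<And>y. y \<in> H T \<Longrightarrow> \<exists>c>0. \<exists>C. \<forall>x\<in>H T. c * sumsq T x - C \<le> J T F u x y"
  shows "is_max_min (H T) (H T) (J T F u) (J T F u a b)"
proof -
  have "\<exists>x\<in>H T. \<forall>z\<in>H T. J T F u x y \<le> J T F u z y" if y: "y \<in> H T" for y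
  proof -
    obtain c C where c: "c > 0" and C: "\<And>x. x \<in> H T \<Longrightarrow> c * sumsq T x - C \<le> J T F u x y"
      using coercive[OF y] by blast
    \<comment> \<open>Where \<open>sumsq\<close> exceeds \<open>M\<close>, coercivity puts
      \<open>J\<close> above its value at zero, so a minimiser on the box is global. The maximum
      with \<open>0\<close> in the radius places zero in the box whatever the sign of
      \<open>M\<close>.\<close>
    define M where "M = (J T F u (\<lambda>_. 0) y + C) / c"
    let ?B = "H_box T (max (M + 1) 0)"
    have zero: "(\<lambda>_. 0) \<in> ?B" using zero_in_H by (simp add: H_box_def)
    have "continuous_on ?B (\<lambda>x. J T F u x y)"
      unfolding continuous_on_def
    proof
      fix p assume "p \<in> ?B"
      have "((\<lambda>q. q k) \<longlongrightarrow> p k) (at p within ?B)" for k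
        using tendsto_ident_at[of p ?B] by (simp add: tendsto_fun_iff)
      then show "((\<lambda>x. J T F u x y) \<longlongrightarrow> J T F u p y) (at p within ?B)"
        by (intro J_tendsto[OF F] tendsto_const)
    qed
    then obtain x where x: "x \<in> ?B" "\<And>z. z \<in> ?B \<Longrightarrow> J T F u x y \<le> J T F u z y"
      using continuous_attains_inf[OF compact_H_box] zero by blast
    have "J T F u x y \<le> J T F u z y" if z: "z \<in> H T" for z
    proof (cases "sumsq T z \<le> M")
      case True
      then show ?thesis
        using abs_le_if_sumsq_le[OF z True] z by (intro x(2)) (auto simp: H_box_def le_max_iff_disj)
    next
      case False
      then have "J T F u (\<lambda>_. 0) y \<le> c * sumsq T z - C"
        using c by (simp add: M_def not_le pos_divide_less_eq mult.commute)
      then show ?thesis using C[OF z] x(2)[OF zero] by linarith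
    qed
    then show ?thesis using x(1) by (auto simp: H_box_def)
  qed
  then obtain m where m: "\<And>y. y \<in> H T \<Longrightarrow> m y \<in> H T"
    "\<And>y z. y \<in> H T \<Longrightarrow> z \<in> H T \<Longrightarrow> J T F u (m y) y \<le> J T F u z y"
    by metis
  have ab: "a \<in> H T" "b \<in> H T" "\<And>y. y \<in> H T \<Longrightarrow> J T F u a y \<le> J T F u a b"
    "\<And>x. x \<in> H T \<Longrightarrow> J T F u a b \<le> J T F u x b"
    using V by (auto simp: V_def)
  have val: "J T F u (m b) b = J T F u a b" using m ab by (meson order.antisym)
  have "J T F u (m y) y \<le> J T F u a b" if "y \<in> H T" for y
    using m(2)[OF that ab(1)] ab(3)[OF that] by simp
  then have "is_maximum ((\<lambda>y. J T F u (m y) y) ` H T) (J T F u a b)"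
    using val ab(2) by (auto simp: is_maximum_def intro!: rev_image_eqI[of b])
  moreover have "\<forall>y\<in>H T. is_minimum ((\<lambda>x. J T F u x y) ` H T) (J T F u (m y) y)"
    using m by (auto simp: is_minimum_def)
  ultimately show ?thesis
    unfolding is_max_min_def by (intro exI[of _ "\<lambda>y. J T F u (m y) y"]) auto
qed

section \<open>Coordinatewise convergence and the two norms\<close>

lemma H_norm_tendsto_0:
  assumes "\<And>k. (\<lambda>i. x i k) \<longlonglongrightarrow> a k"
  shows "(\<lambda>i. H_norm T (\<lambda>k. x i k - a k)) \<longlonglongrightarrow> 0"
proof -
  have "(\<lambda>i. H_norm T (\<lambda>k. x i k - a k)) \<longlonglongrightarrow> H_norm T (\<lambda>k. a k - a k)"
    unfolding H_norm_def fdiff_def by (intro tendsto_intros assms)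
  then show ?thesis by (simp add: H_norm_def fdiff_def)
qed

lemma tendsto_if_max_norm_tendsto:
  assumes "(\<lambda>n. max_norm T (\<lambda>k. u n k - v k)) \<longlonglongrightarrow> 0" "k \<in> {1..T}"
  shows "(\<lambda>n. u n k) \<longlonglongrightarrow> v k"
proof (rule LIM_zero_cancel, rule Lim_null_comparison[OF _ assms(1)])
  have "norm (u n k - v k) \<le> max_norm T (\<lambda>k. u n k - v k)" for n
    unfolding max_norm_def using assms(2) by (intro Max_ge) auto
  then show "\<forall>\<^sub>F n in sequentially. norm (u n k - v k) \<le> max_norm T (\<lambda>k. u n k - v k)" by simp
qed

theorem theorem7:
  fixes T :: nat and D :: real
    and F :: "nat \<Rightarrow> real \<Rightarrow> real \<Rightarrow> real \<Rightarrow> real"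
  assumes T: "T \<ge> 2" and D: "D > 0"
    and F_cont: "continuous_on ({1..T} \<times> UNIV \<times> UNIV \<times> UNIV) (\<lambda>(k, x, y, u). F k x y u)"
    and F_diff_x: "\<And>k x y u. k \<in> {1..T} \<Longrightarrow> (\<lambda>s. F k s y u) differentiable (at x)"
    and F_diff_y: "\<And>k x y u. k \<in> {1..T} \<Longrightarrow> (\<lambda>s. F k x s u) differentiable (at y)"
    and Fx_cont: "continuous_on ({1..T} \<times> UNIV \<times> UNIV \<times> UNIV) (\<lambda>(k, x, y, u). partial_x F k x y u)"
    and Fy_cont: "continuous_on ({1..T} \<times> UNIV \<times> UNIV \<times> UNIV) (\<lambda>(k, x, y, u). partial_y F k x y u)"
    and growth_x: "\<And>y. y \<in> H T \<Longrightarrow>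
      \<exists>\<beta>\<^sub>1::real. \<exists>\<gamma>\<^sub>1::nat \<Rightarrow> real. \<exists>\<alpha>\<^sub>1 < 1 / (2 * c2 T).
        \<forall>x u. \<forall>k\<in>{1..T}. \<bar>u\<bar> \<le> D \<longrightarrow> F k x (y k) u \<ge> - \<alpha>\<^sub>1 * \<bar>x\<bar>\<^sup>2 + \<beta>\<^sub>1 * x + \<gamma>\<^sub>1 k"
    and growth_y: "\<And>x. x \<in> H T \<Longrightarrow>
      \<exists>\<beta>\<^sub>2::real. \<exists>\<gamma>\<^sub>2::nat \<Rightarrow> real. \<exists>\<alpha>\<^sub>2 < 1 / (2 * c2 T).
        \<forall>y u. \<forall>k\<in>{1..T}. \<bar>u\<bar> \<le> D \<longrightarrow> F k (x k) y u \<le> \<alpha>\<^sub>2 * \<bar>y\<bar>\<^sup>2 + \<beta>\<^sub>2 * y + \<gamma>\<^sub>2 k"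
    and J_convex: "\<And>y u. y \<in> H T \<Longrightarrow> u \<in> L T D \<Longrightarrow> convex_functional (H T) (\<lambda>x. J T F u x y)"
    and J_concave: "\<And>x u. x \<in> H T \<Longrightarrow> u \<in> L T D \<Longrightarrow> concave_functional (H T) (\<lambda>y. J T F u x y)"
  shows "(\<forall>u\<in>L T D. \<exists>(x, y)\<in>V T F u. solves_P T F u x y) \<and>
    (\<forall>(u :: nat \<Rightarrow> nat \<Rightarrow> real) u\<^sub>0 (x :: nat \<Rightarrow> nat \<Rightarrow> real) (y :: nat \<Rightarrow> nat \<Rightarrow> real).
       (\<forall>n. u n \<in> L T D) \<and> u\<^sub>0 \<in> L T D \<and>
       (\<lambda>n. max_norm T (\<lambda>k. u n k - u\<^sub>0 k)) \<longlonglongrightarrow> 0 \<and>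
       (\<forall>n. (x n, y n) \<in> V T F (u n) \<and> solves_P T F (u n) (x n) (y n))
       \<longrightarrow>
       (\<exists>r x\<^sub>0 y\<^sub>0. strict_mono r \<and> x\<^sub>0 \<in> H T \<and> y\<^sub>0 \<in> H T \<and>
          (\<lambda>i. H_norm T (\<lambda>k. x (r i) k - x\<^sub>0 k)) \<longlonglongrightarrow> 0 \<and>
          (\<lambda>i. H_norm T (\<lambda>k. y (r i) k - y\<^sub>0 k)) \<longlonglongrightarrow> 0 \<and>
          is_max_min (H T) (H T) (J T F u\<^sub>0) (J T F u\<^sub>0 x\<^sub>0 y\<^sub>0) \<and>
          (x\<^sub>0, y\<^sub>0) \<in> V T F u\<^sub>0 \<and>
          solves_P T F u\<^sub>0 x\<^sub>0 y\<^sub>0))"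
proof -
  have T1: "T \<ge> 1" using T by simp
  have coercive: "\<exists>c>0. \<exists>C. \<forall>u\<in>L T D. \<forall>x\<in>H T. c * sumsq T x - C \<le> J T F u x y" if y: "y \<in> H T" for y
  proof -
    obtain \<beta> \<gamma> \<alpha> where "\<alpha> < 1 / (2 * c2 T)"
      "\<And>s v k. k \<in> {1..T} \<Longrightarrow> \<bar>v\<bar> \<le> D \<Longrightarrow> F k s (y k) v \<ge> - \<alpha> * \<bar>s\<bar>\<^sup>2 + \<beta> * s + \<gamma> k"
      using growth_x[OF y] by blast
    then show ?thesis by (rule J_coercive[OF T1])
  qed
  have anticoercive: "\<exists>c>0. \<exists>C. \<forall>u\<in>L T D. \<forall>y\<in>H T. J T F u x y \<le> C - c * sumsq T y" if x: "x \<in> H T" for x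
  proof -
    obtain \<beta> \<gamma> \<alpha> where \<alpha>: "\<alpha> < 1 / (2 * c2 T)" and
      g: "\<And>s v k. k \<in> {1..T} \<Longrightarrow> \<bar>v\<bar> \<le> D \<Longrightarrow> F k (x k) s v \<le> \<alpha> * \<bar>s\<bar>\<^sup>2 + \<beta> * s + \<gamma> k"
      using growth_y[OF x] by blast
    \<comment> \<open>Under the exchange of players the rate \<open>\<alpha>\<close> is kept, while
      \<open>\<beta>\<close> and \<open>\<gamma>\<close> change sign.\<close>
    have "- F k (x k) s v \<ge> - \<alpha> * \<bar>s\<bar>\<^sup>2 + (- \<beta>) * s + (- \<gamma> k)" if "k \<in> {1..T}" "\<bar>v\<bar> \<le> D" for s v k
      using g[OF that, of s] by simp
    from J_coercive[OF T1 \<alpha>, where F = "\<lambda>k x y u. - F k y x u", OF this]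
    obtain c C where c: "c > 0"
      "\<And>u y. u \<in> L T D \<Longrightarrow> y \<in> H T \<Longrightarrow> c * sumsq T y - C \<le> J T (\<lambda>k x y u. - F k y x u) u y x"
      by blast
    have "J T F u x y \<le> C - c * sumsq T y" if "u \<in> L T D" "y \<in> H T" for u y
      using c(2)[OF that] J_swap[of T F u x y] by simp
    then show ?thesis using c(1) by blast
  qed
  obtain c C where low: "0 < c" "\<And>u x. u \<in> L T D \<Longrightarrow> x \<in> H T \<Longrightarrow> c * sumsq T x - C \<le> J T F u x (\<lambda>_. 0)"
    using coercive[OF zero_in_H] by blast
  obtain c' C' where upp: "0 < c'" "\<And>u y. u \<in> L T D \<Longrightarrow> y \<in> H T \<Longrightarrow> J T F u (\<lambda>_. 0) y \<le> C' - c' * sumsq T y"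
    using anticoercive[OF zero_in_H] by blast
  have solves: "solves_P T F u x y" if "(x, y) \<in> V T F u" for u x y
    by (rule saddle_point_solves[OF that]) (auto intro: F_diff_x F_diff_y)
  \<comment> \<open>This serves twice: with growing boxes and vanishing penalties it gives
    existence, with \<open>A n = H T\<close> and zero penalty it gives the convergent subsequence of
    exact saddle points.\<close>
  note limit = approximate_saddles_limit[OF F_cont low upp]
  have "\<exists>(x, y)\<in>V T F u. solves_P T F u x y" if u: "u \<in> L T D" for u
  proof -
    let ?e = "\<lambda>n. inverse (real (Suc n))" and ?A = "\<lambda>n. H_box T (real n)"
    have "\<forall>n. \<exists>a b. a \<in> ?A n \<and> b \<in> ?A n \<and> (\<forall>x\<in>?A n. \<forall>y\<in>?A n.
        J T F u a y + ?e n * sumsq T a \<le> J T F u x b + ?e n * sumsq T x)"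
      using regularized_saddle[OF F_cont J_convex[OF _ u] J_concave[OF _ u]] by (simp add: Bex_def)
    then obtain a b where ab: "\<And>n. a n \<in> ?A n" "\<And>n. b n \<in> ?A n"
      "\<And>n x y. x \<in> ?A n \<Longrightarrow> y \<in> ?A n \<Longrightarrow>
        J T F u (a n) y + ?e n * sumsq T (a n) \<le> J T F u x (b n) + ?e n * sumsq T x"
      by metis
    \<comment> \<open>The boxes exhaust \<open>H T\<close>, because each of its elements is
      bounded.\<close>
    have ev: "\<forall>\<^sub>F n in sequentially. z \<in> ?A n" if z: "z \<in> H T" for z
    proof -
      obtain N where "sumsq T z + 1 \<le> real N" using real_arch_simple by blast
      then have "\<bar>z k\<bar> \<le> real n" if "n \<ge> N" for n k
        using abs_le_if_sumsq_le[OF z order.refl, of k] that by linarith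
      then show ?thesis using z by (auto simp: eventually_sequentially H_box_def)
    qed
    have "\<exists>r x y. strict_mono r \<and> (x, y) \<in> V T F u \<and>
        (\<forall>k. (\<lambda>i. a (r i) k) \<longlonglongrightarrow> x k) \<and> (\<forall>k. (\<lambda>i. b (r i) k) \<longlonglongrightarrow> y k)"
    proof (rule limit[where u = "\<lambda>_. u" and e = ?e and A = ?A])
      show "?A n \<subseteq> H T" "(\<lambda>_. 0) \<in> ?A n" for n
        using zero_in_H by (auto simp: H_box_def)
      show "?e \<longlonglongrightarrow> 0" by (rule LIMSEQ_inverse_real_of_nat)
    qed (rule u ab ev tendsto_const | assumption | simp)+
    then show ?thesis using solves by blast
  qed
  moreover have "\<forall>(u :: nat \<Rightarrow> nat \<Rightarrow> real) u\<^sub>0 (x :: nat \<Rightarrow> nat \<Rightarrow> real) (y :: nat \<Rightarrow> nat \<Rightarrow> real).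
       (\<forall>n. u n \<in> L T D) \<and> u\<^sub>0 \<in> L T D \<and>
       (\<lambda>n. max_norm T (\<lambda>k. u n k - u\<^sub>0 k)) \<longlonglongrightarrow> 0 \<and>
       (\<forall>n. (x n, y n) \<in> V T F (u n) \<and> solves_P T F (u n) (x n) (y n))
       \<longrightarrow>
       (\<exists>r x\<^sub>0 y\<^sub>0. strict_mono r \<and> x\<^sub>0 \<in> H T \<and> y\<^sub>0 \<in> H T \<and>
          (\<lambda>i. H_norm T (\<lambda>k. x (r i) k - x\<^sub>0 k)) \<longlonglongrightarrow> 0 \<and>
          (\<lambda>i. H_norm T (\<lambda>k. y (r i) k - y\<^sub>0 k)) \<longlonglongrightarrow> 0 \<and>
          is_max_min (H T) (H T) (J T F u\<^sub>0) (J T F u\<^sub>0 x\<^sub>0 y\<^sub>0) \<and>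
          (x\<^sub>0, y\<^sub>0) \<in> V T F u\<^sub>0 \<and>
          solves_P T F u\<^sub>0 x\<^sub>0 y\<^sub>0)"
    (is "\<forall>u u\<^sub>0 x y. ?hyp u u\<^sub>0 x y \<longrightarrow> ?concl u\<^sub>0 x y")
  proof (intro allI impI)
    fix u u\<^sub>0 and x y :: "nat \<Rightarrow> nat \<Rightarrow> real"
    assume "?hyp u u\<^sub>0 x y"
    then have u: "\<And>n. u n \<in> L T D" and u0: "u\<^sub>0 \<in> L T D"
      and conv: "(\<lambda>n. max_norm T (\<lambda>k. u n k - u\<^sub>0 k)) \<longlonglongrightarrow> 0"
      and xy: "\<And>n. (x n, y n) \<in> V T F (u n)"
      by simp_all
    have H: "x n \<in> H T" "y n \<in> H T" for n using xy[of n] by (auto simp: V_def)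
    have saddle: "J T F (u n) (x n) w \<le> J T F (u n) z (y n)" if "z \<in> H T" "w \<in> H T" for n z w
      using xy[of n] that unfolding V_def by (blast intro: order.trans)
    have "\<exists>r a b. strict_mono r \<and> (a, b) \<in> V T F u\<^sub>0 \<and>
        (\<forall>k. (\<lambda>i. x (r i) k) \<longlonglongrightarrow> a k) \<and> (\<forall>k. (\<lambda>i. y (r i) k) \<longlonglongrightarrow> b k)"
      by (rule limit[where u = u and e = "\<lambda>_. 0" and A = "\<lambda>_. H T"])
         (use u H saddle zero_in_H tendsto_if_max_norm_tendsto[OF conv] in auto)
    then obtain r a b where r: "strict_mono r" and ab: "(a, b) \<in> V T F u\<^sub>0"
      and lim: "\<And>k. (\<lambda>i. x (r i) k) \<longlonglongrightarrow> a k" "\<And>k. (\<lambda>i. y (r i) k) \<longlonglongrightarrow> b k"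
      by blast
    have "is_max_min (H T) (H T) (J T F u\<^sub>0) (J T F u\<^sub>0 a b)"
      using coercive u0 by (intro saddle_value_is_max_min[OF ab F_cont]) blast
    moreover have "a \<in> H T" "b \<in> H T" using ab by (auto simp: V_def)
    ultimately show "?concl u\<^sub>0 x y"
      using r ab solves[OF ab]
      by (intro exI[of _ r] exI[of _ a] exI[of _ b] conjI H_norm_tendsto_0 lim)
  qed
  ultimately show ?thesis by (rule conjI[OF ballI])
qed

end
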